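(* (i) An integer $a$ is $\circ$-prime if and only if $p=|3a-1|$ is a prime number in the classical sense. (ii) Any nonzero integer $a$ can be decomposed as $a=q_1\circ\cdots\circ q_k$, where each $q_i$ is $\circ$-prime, and such a decomposition is unique up to reordering.
   Context: On the set $\mathbb{Z}$ of integers define the operation $a\circ b=a+b-3ab$ (it is associative and commutative, with unit $0$; it is the multiplication of the elliptic ring $Ell_1(\mathbb{Z})$). A non-zero integer $a$ is called $\circ$-prime if it has no non-trivial decomposition, i.e. if $a=b\circ c$ with $b,c\in\mathbb{Z}$ implies $b=0$ or $c=0$. *)

theory Defs
  imports "HOL-Computational_Algebra.Primes" "HOL-Library.Multiset"
begin

definition circ :: "int \<Rightarrow> int \<Rightarrow> int"  (infixl "\<circ>\<^sub>e" 70)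
  where "a \<circ>\<^sub>e b = a + b - 3 * a * b"

lemma circ_assoc: "(a \<circ>\<^sub>e b) \<circ>\<^sub>e c = a \<circ>\<^sub>e (b \<circ>\<^sub>e c)"
  by (simp add: circ_def algebra_simps)

lemma circ_commute: "a \<circ>\<^sub>e b = b \<circ>\<^sub>e a"
  by (simp add: circ_def)

lemma circ_0_left [simp]: "0 \<circ>\<^sub>e a = a"
  and circ_0_right [simp]: "a \<circ>\<^sub>e 0 = a"
  by (simp_all add: circ_def)

definition circ_prime :: "int \<Rightarrow> bool"
  where "circ_prime a \<longleftrightarrow> a \<noteq> 0 \<and> (\<forall>b c. a = b \<circ>\<^sub>e c \<longrightarrow> b = 0 \<or> c = 0)"

definition circ_list :: "int list \<Rightarrow> int"
  where "circ_list qs = foldr (\<circ>\<^sub>e) qs 0"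

definition circ_factorization :: "int list \<Rightarrow> int \<Rightarrow> bool"
  where "circ_factorization qs a \<longleftrightarrow>
    qs \<noteq> [] \<and> (\<forall>q \<in> set qs. circ_prime q) \<and> a = circ_list qs"

end

theory Submission
  imports Defs
begin

text \<open>
  The map \<open>a \<mapsto> 1 - 3 * a\<close> turns \<open>\<circ>\<^sub>e\<close> into multiplication and identifies the integers with
  the multiplicative monoid of integers congruent to \<open>1\<close> modulo \<open>3\<close>. Exactly one of \<open>x\<close> and
  \<open>- x\<close> lies in this monoid whenever \<open>3\<close> does not divide \<open>x\<close>, so passing to absolute values
  identifies it with the positive integers prime to \<open>3\<close>. Both claims are then
  instances of unique factorization in the integers.
\<close>

definition circ_norm :: "int \<Rightarrow> int"
  where "circ_norm a = \<bar>3 * a - 1\<bar>"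

lemma circ_norm_circ: "circ_norm (a \<circ>\<^sub>e b) = circ_norm a * circ_norm b"
proof -
  have "3 * (a \<circ>\<^sub>e b) - 1 = - ((3 * a - 1) * (3 * b - 1))"
    by (simp add: circ_def algebra_simps)
  then show ?thesis
    by (simp add: circ_norm_def abs_mult)
qed

lemma circ_norm_0 [simp]: "circ_norm 0 = 1"
  by (simp add: circ_norm_def)

lemma circ_norm_pos: "circ_norm a > 0"
  unfolding circ_norm_def by presburger

text \<open>Two values \<open>3 * a - 1\<close> and \<open>3 * b - 1\<close> cannot be negatives of
  each other, since \<open>3 * (a + b) = 2\<close> has no integer solution.\<close>

lemma inj_circ_norm: "inj circ_norm"
  by (rule injI) (unfold circ_norm_def, presburger)

lemma circ_norm_eq_1_iff: "circ_norm a = 1 \<longleftrightarrow> a = 0"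
  using inj_circ_norm by (metis circ_norm_0 injD)

text \<open>The residue of \<open>x\<close> modulo 3 decides the sign: \<open>x = 1 - 3 * a\<close>
  if it is 1, \<open>x = 3 * a - 1\<close> if it is 2.\<close>

lemma circ_norm_surj:
  assumes "x > 0" and "\<not> 3 dvd x"
  obtains a where "circ_norm a = x"
proof -
  have "x mod 3 = 1 \<or> x mod 3 = 2"
    using assms by presburger
  then show thesis
  proof
    assume "x mod 3 = 1"
    then have "3 * ((1 - x) div 3) = 1 - x"
      by presburger
    then show thesis
      using assms by (intro that[of "(1 - x) div 3"]) (simp add: circ_norm_def)
  next
    assume "x mod 3 = 2"
    then have "3 * ((x + 1) div 3) = x + 1"
      by presburger
    then show thesis
      using assms by (intro that[of "(x + 1) div 3"]) (simp add: circ_norm_def)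
  qed
qed

text \<open>Divisors of a norm are prime to 3, hence norms up to sign, so integer factorizations of
  \<open>circ_norm a\<close> come from decompositions of \<open>a\<close>.\<close>

lemma circ_prime_iff: "circ_prime a \<longleftrightarrow> prime (circ_norm a)"
proof
  assume a: "circ_prime a"
  have "irreducible (circ_norm a)"
  proof (rule irreducibleI)
    show "circ_norm a \<noteq> 0"
      using circ_norm_pos[of a] by simp
    show "\<not> circ_norm a dvd 1"
      using a circ_norm_pos[of a] by (auto simp: circ_prime_def circ_norm_eq_1_iff)
  next
    fix x y
    assume xy: "circ_norm a = x * y"
    have not_3: "\<not> 3 dvd circ_norm a"
      unfolding circ_norm_def by presburger
    have nz: "x \<noteq> 0" "y \<noteq> 0"
      using xy circ_norm_pos[of a] by auto
    \<comment> \<open>The factors may both be negative, and only positive integers are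
      norms.\<close>
    have "\<not> 3 dvd \<bar>x\<bar>" "\<not> 3 dvd \<bar>y\<bar>"
      using not_3 dvd_mult2[of 3 x y] dvd_mult[of 3 y x] by (auto simp only: xy dvd_abs_iff)
    moreover have "\<bar>x\<bar> > 0" "\<bar>y\<bar> > 0"
      using nz by simp_all
    ultimately obtain b c where bc: "circ_norm b = \<bar>x\<bar>" "circ_norm c = \<bar>y\<bar>"
      by (meson circ_norm_surj)
    have "circ_norm a = circ_norm (b \<circ>\<^sub>e c)"
      by (simp add: circ_norm_circ bc xy[symmetric] abs_mult[symmetric] circ_norm_pos less_imp_le)
    then have "a = b \<circ>\<^sub>e c"
      using inj_circ_norm by (simp add: inj_eq)
    then have "b = 0 \<or> c = 0"
      using a by (auto simp: circ_prime_def)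
    then show "x dvd 1 \<or> y dvd 1"
      using bc by auto
  qed
  then have "prime_elem (circ_norm a)"
    by (rule irreducible_imp_prime_elem)
  then show "prime (circ_norm a)"
    by (rule primeI) (simp add: circ_norm_pos less_imp_le)
next
  assume a: "prime (circ_norm a)"
  have "b = 0 \<or> c = 0" if "a = b \<circ>\<^sub>e c" for b c
  proof -
    have "irreducible (circ_norm b * circ_norm c)"
      using prime_elem_imp_irreducible[OF prime_imp_prime_elem[OF a]]
      by (simp only: that circ_norm_circ)
    then have "circ_norm b dvd 1 \<or> circ_norm c dvd 1"
      by (rule irreducibleD) simp
    \<comment> \<open>A positive unit is 1, which is the norm of 0 alone.\<close>
    then show ?thesis
      using circ_norm_pos[of b] circ_norm_pos[of c] by (auto simp: circ_norm_eq_1_iff)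
  qed
  moreover have "a \<noteq> 0"
    using a by auto
  ultimately show "circ_prime a"
    by (simp add: circ_prime_def)
qed

lemma circ_list_Nil [simp]: "circ_list [] = 0"
  and circ_list_Cons [simp]: "circ_list (q # qs) = q \<circ>\<^sub>e circ_list qs"
  by (simp_all add: circ_list_def)

lemma circ_list_append: "circ_list (qs @ rs) = circ_list qs \<circ>\<^sub>e circ_list rs"
  by (induction qs) (simp_all add: circ_assoc)

lemma circ_norm_circ_list: "circ_norm (circ_list qs) = prod_mset (image_mset circ_norm (mset qs))"
  by (induction qs) (simp_all add: circ_norm_circ)

text \<open>This makes the norm a measure that drops in every non-trivial decomposition, as the
  induction for existence requires.\<close>

lemma circ_norm_less:
  assumes "c \<noteq> 0"
  shows "circ_norm b < circ_norm (b \<circ>\<^sub>e c)"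
proof -
  have "1 < circ_norm c"
    using assms circ_norm_pos[of c] circ_norm_eq_1_iff[of c] by linarith
  then show ?thesis
    using circ_norm_pos[of b] by (simp add: circ_norm_circ)
qed

lemma circ_factorization_exists: "a \<noteq> 0 \<Longrightarrow> \<exists>qs. circ_factorization qs a"
proof (induction "nat (circ_norm a)" arbitrary: a rule: less_induct)
  case less
  show ?case
  proof (cases "circ_prime a")
    case True
    then have "circ_factorization [a] a"
      by (simp add: circ_factorization_def)
    then show ?thesis ..
  next
    case False
    then obtain b c where bc: "a = b \<circ>\<^sub>e c" "b \<noteq> 0" "c \<noteq> 0"
      using less.prems by (auto simp: circ_prime_def)
    then have "circ_norm b < circ_norm a" "circ_norm c < circ_norm a"
      using circ_norm_less[of c b] circ_norm_less[of b c] by (simp_all add: circ_commute)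
    then have "nat (circ_norm b) < nat (circ_norm a)" "nat (circ_norm c) < nat (circ_norm a)"
      using circ_norm_pos[of a] by simp_all
    then obtain qs rs where "circ_factorization qs b" "circ_factorization rs c"
      using less.hyps bc by meson
    then have "circ_factorization (qs @ rs) a"
      using bc by (auto simp: circ_factorization_def circ_list_append)
    then show ?thesis ..
  qed
qed

text \<open>The norms of the factors are positive primes with product \<open>circ_norm a\<close>, so
  classical unique factorization determines them as a multiset from \<open>a\<close> alone.\<close>

lemma circ_factorization_mset:
  assumes "circ_factorization qs a"
  shows "image_mset circ_norm (mset qs) = prime_factorization (circ_norm a)"
proof -
  have "prime_factorization (prod_mset (image_mset circ_norm (mset qs))) =
      image_mset circ_norm (mset qs)"
    by (rule prime_factorization_prod_mset_primes)
      (use assms in \<open>auto simp: circ_factorization_def circ_prime_iff\<close>)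
  then show ?thesis
    using assms by (simp add: circ_factorization_def circ_norm_circ_list)
qed

lemma circ_factorization_unique:
  assumes "circ_factorization qs a" and "circ_factorization rs a"
  shows "mset qs = mset rs"
proof -
  have "image_mset circ_norm (mset qs) = image_mset circ_norm (mset rs)"
    using assms by (simp add: circ_factorization_mset)
  \<comment> \<open>Injectivity of \<open>circ_norm\<close> lifts to
    \<open>image_mset circ_norm\<close>, so the factors are recovered from their norms.\<close>
  then show ?thesis
    using multiset.inj_map[OF inj_circ_norm] by (simp add: inj_eq)
qed

theorem theorem13p3:
  "(\<forall>a::int. circ_prime a \<longleftrightarrow> prime \<bar>3 * a - 1\<bar>) \<and>
   (\<forall>a::int. a \<noteq> 0 \<longrightarrow>
      (\<exists>qs. circ_factorization qs a) \<and>
      (\<forall>qs rs. circ_factorization qs a \<and> circ_factorization rs a \<longrightarrow> mset qs = mset rs))"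
proof (intro conjI allI impI)
  show "circ_prime a \<longleftrightarrow> prime \<bar>3 * a - 1\<bar>" for a
    using circ_prime_iff[of a] by (simp only: circ_norm_def)
  show "\<exists>qs. circ_factorization qs a" if "a \<noteq> 0" for a
    using that by (rule circ_factorization_exists)
  show "mset qs = mset rs" if "circ_factorization qs a \<and> circ_factorization rs a" for a qs rs
    using that circ_factorization_unique by blast
qed

end
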